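(* Let $\mathcal{M}$ be a unitary magma and $B$, $E$, and $D$ be three subsets of $\mathcal{M}$. If $\mathbb{1}_{\mathcal{M}}\in B$, $\mathbb{1}_{\mathcal{M}}\in D$, and $E\star B\subseteq D$, then $\mathsf{Lab}_{B,E,D}\mathcal{M}$ is a suboperad of $\mathsf{C}\mathcal{M}$.
   Context: Let $\mathbb{K}$ be a field of characteristic zero and $[n]=\{1,\dots,n\}$. A unitary magma is a set $\mathcal{M}$ with a binary operation $\star$ (not assumed associative) having a two-sided unit $\mathbb{1}_{\mathcal{M}}$. Operads are nonsymmetric operads in $\mathbb{K}$-vector spaces (graded from arity $1$, with partial compositions $\circ_i$ and a unit of arity $1$). A suboperad is a graded subspace containing the unit and closed under all partial compositions. An $\mathcal{M}$-clique of arity $n\ge1$ is a map $\mathfrak{p}$ assigning a label $\mathfrak{p}(x,y)\in\mathcal{M}$ to each arc $(x,y)$, $1\le x<y\le n+1$; by convention the only $\mathcal{M}$-clique of arity $1$ is $\mathbf{u}$, with $\mathbf{u}(1,2)=\mathbb{1}_{\mathcal{M}}$. The arc $(1,n+1)$ is the base; the arcs $(x,x+1)$ different from $(1,n+1)$ are the edges; all other arcs are diagonals. Write $\mathfrak{p}_0:=\mathfrak{p}(1,n+1)$ and $\mathfrak{p}_i:=\mathfrak{p}(i,i+1)$ for $i\in[n]$. $\mathsf{C}\mathcal{M}$ is the operad (with unit $\mathbf{u}$) such that $\mathsf{C}\mathcal{M}(n)$ has basis the $\mathcal{M}$-cliques of arity $n$, and for $\mathcal{M}$-cliques $\mathfrak{p},\mathfrak{q}$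 of arities $n,m$ and $i\in[n]$, $\mathfrak{p}\circ_i\mathfrak{q}$ is the $\mathcal{M}$-clique of arity $n+m-1$ with, for $1\le x<y\le n+m$, $$(\mathfrak{p}\circ_i\mathfrak{q})(x,y)=\begin{cases}\mathfrak{p}(x,y)&\text{if }y\le i,\\ \mathfrak{p}(x,y-m+1)&\text{if }x\le i<i+m\le y,\ (x,y)\ne(i,i+m),\\ \mathfrak{p}(x-m+1,y-m+1)&\text{if }i+m\le x,\\ \mathfrak{q}(x-i+1,y-i+1)&\text{if }i\le x<y\le i+m,\ (x,y)\ne(i,i+m),\\ \mathfrak{p}_i\star\mathfrak{q}_0&\text{if }(x,y)=(i,i+m),\\ \mathbb{1}_{\mathcal{M}}&\text{otherwise}.\end{cases}$$ For $X,Y\subseteq\mathcal{M}$, $X\star Y=\{x\star y:x\in X,y\in Y\}$. $\mathsf{Lab}_{B,E,D}\mathcal{M}$ is the subspace of $\mathsf{C}\mathcal{M}$ spanned by all $\mathcal{M}$-cliques whose base is labeled by an element of $B$, whose edges are all labeled by elements of $E$, and whose diagonals are all labeled by elements of $D$. *)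

theory Defs
  imports Complex_Main "HOL-Library.FuncSet" "HOL-Library.Poly_Mapping"
begin

locale unitary_magma =
  fixes star :: "'m \<Rightarrow> 'm \<Rightarrow> 'm" (infixl "\<star>" 70)
    and e :: 'm
  assumes left_unit: "e \<star> x = x"
    and right_unit: "x \<star> e = x"

definition set_star :: "('m \<Rightarrow> 'm \<Rightarrow> 'm) \<Rightarrow> 'm set \<Rightarrow> 'm set \<Rightarrow> 'm set" where
  "set_star star X Y = {star x y | x y. x \<in> X \<and> y \<in> Y}"


subsection \<open>Nonsymmetric operads in vector spaces\<close>

text \<open>The component of arity \<open>n \<ge> 1\<close> is the subspace \<open>component P n\<close> of one ambient vector
  space; components of different arities need not be disjoint, so \<open>pcomp P n m i f g\<close>, the
  partial composition of \<open>f\<close> and \<open>g\<close> at \<open>i\<close>, takes their arities \<open>n\<close> and \<open>m\<close> as arguments.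
  Arity 0 is never considered.\<close>

record ('k, 'v) ns_operad_data =
  scale :: "'k \<Rightarrow> 'v \<Rightarrow> 'v"
  component :: "nat \<Rightarrow> 'v set"
  pcomp :: "nat \<Rightarrow> nat \<Rightarrow> nat \<Rightarrow> 'v \<Rightarrow> 'v \<Rightarrow> 'v"
  op_unit :: 'v

locale ns_operad = vector_space "scale P"
  for P :: "('k::field, 'v::ab_group_add) ns_operad_data" +
  assumes subspace_component: "n \<ge> 1 \<Longrightarrow> subspace (component P n)"
    and unit_component: "op_unit P \<in> component P 1"
    and pcomp_component: "\<lbrakk>n \<ge> 1; m \<ge> 1; i \<in> {1..n}; f \<in> component P n; g \<in> component P m\<rbrakk>
      \<Longrightarrow> pcomp P n m i f g \<in> component P (n + m - 1)"
    and pcomp_add_left: "\<lbrakk>n \<ge> 1; m \<ge> 1; i \<in> {1..n}; f \<in> component P n; f' \<in> component P n;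
        g \<in> component P m\<rbrakk>
      \<Longrightarrow> pcomp P n m i (f + f') g = pcomp P n m i f g + pcomp P n m i f' g"
    and pcomp_add_right: "\<lbrakk>n \<ge> 1; m \<ge> 1; i \<in> {1..n}; f \<in> component P n; g \<in> component P m;
        g' \<in> component P m\<rbrakk>
      \<Longrightarrow> pcomp P n m i f (g + g') = pcomp P n m i f g + pcomp P n m i f g'"
    and pcomp_scale_left: "\<lbrakk>n \<ge> 1; m \<ge> 1; i \<in> {1..n}; f \<in> component P n; g \<in> component P m\<rbrakk>
      \<Longrightarrow> pcomp P n m i (scale P c f) g = scale P c (pcomp P n m i f g)"
    and pcomp_scale_right: "\<lbrakk>n \<ge> 1; m \<ge> 1; i \<in> {1..n}; f \<in> component P n; g \<in> component P m\<rbrakk>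
      \<Longrightarrow> pcomp P n m i f (scale P c g) = scale P c (pcomp P n m i f g)"
    and pcomp_unit_left: "\<lbrakk>m \<ge> 1; g \<in> component P m\<rbrakk> \<Longrightarrow> pcomp P 1 m 1 (op_unit P) g = g"
    and pcomp_unit_right: "\<lbrakk>n \<ge> 1; i \<in> {1..n}; f \<in> component P n\<rbrakk>
      \<Longrightarrow> pcomp P n 1 i f (op_unit P) = f"
    and pcomp_assoc: "\<lbrakk>n \<ge> 1; m \<ge> 1; l \<ge> 1; i \<in> {1..n}; j \<in> {1..m};
        f \<in> component P n; g \<in> component P m; h \<in> component P l\<rbrakk>
      \<Longrightarrow> pcomp P (n + m - 1) l (i + j - 1) (pcomp P n m i f g) h
          = pcomp P n (m + l - 1) i f (pcomp P m l j g h)"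
    and pcomp_commute: "\<lbrakk>n \<ge> 1; m \<ge> 1; l \<ge> 1; i \<in> {1..n}; j \<in> {1..n}; i < j;
        f \<in> component P n; g \<in> component P m; h \<in> component P l\<rbrakk>
      \<Longrightarrow> pcomp P (n + m - 1) l (j + m - 1) (pcomp P n m i f g) h
          = pcomp P (n + l - 1) m i (pcomp P n l j f h) g"

locale ns_suboperad = ns_operad P
  for P :: "('k::field, 'v::ab_group_add) ns_operad_data" +
  fixes S :: "nat \<Rightarrow> 'v set"
  assumes sub_subset: "n \<ge> 1 \<Longrightarrow> S n \<subseteq> component P n"
    and sub_subspace: "n \<ge> 1 \<Longrightarrow> subspace (S n)"
    and sub_unit: "op_unit P \<in> S 1"
    and sub_pcomp: "\<lbrakk>n \<ge> 1; m \<ge> 1; i \<in> {1..n}; f \<in> S n; g \<in> S m\<rbrakk>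
      \<Longrightarrow> pcomp P n m i f g \<in> S (n + m - 1)"


subsection \<open>Cliques\<close>

definition arcs :: "nat \<Rightarrow> (nat \<times> nat) set" where
  "arcs n = {(x, y). 1 \<le> x \<and> x < y \<and> y \<le> n + 1}"

definition base :: "nat \<Rightarrow> nat \<times> nat" where
  "base n = (1, n + 1)"

definition edges :: "nat \<Rightarrow> (nat \<times> nat) set" where
  "edges n = {(x, y) \<in> arcs n. y = x + 1} - {base n}"

definition diagonals :: "nat \<Rightarrow> (nat \<times> nat) set" where
  "diagonals n = arcs n - {base n} - edges n"

text \<open>A clique of arity \<open>n\<close> is extensional on \<open>arcs n\<close>: its value elsewhere is
  \<open>undefined\<close>.\<close>

type_synonym 'm clique = "nat \<times> nat \<Rightarrow> 'm"

definition cliques :: "'m \<Rightarrow> nat \<Rightarrow> 'm clique set" where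
  "cliques e n = {p \<in> arcs n \<rightarrow>\<^sub>E UNIV. n = 1 \<longrightarrow> p (1, 2) = e}"

definition unit_clique :: "'m \<Rightarrow> 'm clique" where
  "unit_clique e = (\<lambda>a \<in> arcs 1. e)"

definition clique_comp ::
  "('m \<Rightarrow> 'm \<Rightarrow> 'm) \<Rightarrow> 'm \<Rightarrow> nat \<Rightarrow> nat \<Rightarrow> nat \<Rightarrow> 'm clique \<Rightarrow> 'm clique \<Rightarrow> 'm clique"
  where
  "clique_comp star e n m i p q = (\<lambda>(x, y) \<in> arcs (n + m - 1).
     if y \<le> i then p (x, y)
     else if x \<le> i \<and> i + m \<le> y \<and> (x, y) \<noteq> (i, i + m) then p (x, y - m + 1)
     else if i + m \<le> x then p (x - m + 1, y - m + 1)
     else if i \<le> x \<and> y \<le> i + m \<and> (x, y) \<noteq> (i, i + m) then q (x - i + 1, y - i + 1)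
     else if (x, y) = (i, i + m) then star (p (i, i + 1)) (q (base m))
     else e)"

lemma clique_comp_in_cliques:
  assumes "unitary_magma star e" "n \<ge> 1" "m \<ge> 1" "i \<in> {1..n}" "p \<in> cliques e n" "q \<in> cliques e m"
  shows "clique_comp star e n m i p q \<in> cliques e (n + m - 1)"
proof -
  interpret unitary_magma star e by fact
  have "clique_comp star e n m i p q (1, 2) = e" if "n + m - 1 = 1"
  proof -
    have "n = 1" "m = 1" "i = 1" using that assms by auto
    then show ?thesis
      using assms by (auto simp: clique_comp_def arcs_def base_def cliques_def left_unit
          simp flip: numeral_2_eq_2)
  qed
  then show ?thesis by (auto simp: cliques_def clique_comp_def)
qed

lemma clique_comp_unit_left:
  assumes "unitary_magma star e" "m \<ge> 1" "q \<in> cliques e m"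
  shows "clique_comp star e 1 m 1 (unit_clique e) q = q"
proof -
  interpret unitary_magma star e by fact
  show ?thesis
  proof (rule ext, clarify)
    fix x y show "clique_comp star e 1 m 1 (unit_clique e) q (x, y) = q (x, y)"
      using assms(2,3)
      by (cases "(x, y) \<in> arcs m")
        (auto simp: cliques_def PiE_def extensional_def clique_comp_def unit_clique_def arcs_def
          base_def left_unit)
  qed
qed

lemma clique_comp_unit_right:
  assumes "unitary_magma star e" "n \<ge> 1" "i \<in> {1..n}" "p \<in> cliques e n"
  shows "clique_comp star e n 1 i p (unit_clique e) = p"
proof -
  interpret unitary_magma star e by fact
  show ?thesis
  proof (rule ext, clarify)
    fix x y show "clique_comp star e n 1 i p (unit_clique e) (x, y) = p (x, y)"
      using assms(2-)
      by (cases "(x, y) \<in> arcs n")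
        (auto simp: cliques_def PiE_def extensional_def clique_comp_def unit_clique_def arcs_def
          base_def right_unit le_Suc_eq)
  qed
qed

text \<open>The two associativity laws are proved for an integer-indexed version of
  \<open>clique_comp\<close> in which subtraction does not truncate.\<close>

definition int_clique_comp ::
  "('m \<Rightarrow> 'm \<Rightarrow> 'm) \<Rightarrow> 'm \<Rightarrow> int \<Rightarrow> int \<Rightarrow> (int \<Rightarrow> int \<Rightarrow> 'm) \<Rightarrow> (int \<Rightarrow> int \<Rightarrow> 'm)
    \<Rightarrow> int \<Rightarrow> int \<Rightarrow> 'm" where
  "int_clique_comp star e m i p q x y =
    (if y \<le> i then p x y
     else if x \<le> i \<and> i + m \<le> y \<and> (x \<noteq> i \<or> y \<noteq> i + m) then p x (y - m + 1)
     else if i + m \<le> x then p (x - m + 1) (y - m + 1)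
     else if i \<le> x \<and> y \<le> i + m \<and> (x \<noteq> i \<or> y \<noteq> i + m) then q (x - i + 1) (y - i + 1)
     else if x = i \<and> y = i + m then star (p i (i + 1)) (q 1 (m + 1))
     else e)"

lemma int_clique_comp_assoc:
  assumes "x < y" "1 \<le> j" "j \<le> m" "m \<ge> 2" "l \<ge> 1"
  shows "int_clique_comp star e l (i + j - 1) (int_clique_comp star e m i p q) r x y
       = int_clique_comp star e (m + l - 1) i p (int_clique_comp star e l j q r) x y"
  using assms unfolding int_clique_comp_def by (smt (verit))

lemma int_clique_comp_assoc_1:
  assumes "x < y" "q 1 2 = e" "\<And>x. star e x = x" "\<And>x. star x e = x" "l \<ge> 1"
  shows "int_clique_comp star e l i (int_clique_comp star e 1 i p q) r x y
       = int_clique_comp star e l i p (int_clique_comp star e l 1 q r) x y"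
  using assms unfolding int_clique_comp_def by (smt (verit))

lemma int_clique_comp_commute:
  assumes "x < y" "i < j" "m \<ge> 1" "l \<ge> 1"
  shows "int_clique_comp star e l (j + m - 1) (int_clique_comp star e m i p q) r x y
       = int_clique_comp star e m i (int_clique_comp star e l j p r) q x y"
  using assms unfolding int_clique_comp_def by (smt (verit))

definition int_clique :: "'m clique \<Rightarrow> int \<Rightarrow> int \<Rightarrow> 'm" where
  "int_clique p x y = p (nat x, nat y)"

lemma int_clique_comp_cong:
  assumes "n \<ge> 1" "m \<ge> 1" "1 \<le> i" "i \<le> n" "1 \<le> x" "x < y" "y \<le> n + m"
    and "\<And>x y. 1 \<le> x \<Longrightarrow> x < y \<Longrightarrow> y \<le> n + 1 \<Longrightarrow> p x y = p' x y"
    and "\<And>x y. 1 \<le> x \<Longrightarrow> x < y \<Longrightarrow> y \<le> m + 1 \<Longrightarrow> q x y = q' x y"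
  shows "int_clique_comp star e m i p q x y = int_clique_comp star e m i p' q' x y"
  using assms unfolding int_clique_comp_def by (smt (verit))

lemma int_clique_clique_comp:
  assumes "n \<ge> 1" "m \<ge> 1" "1 \<le> i" "i \<le> n" "1 \<le> x" "x < y" "y \<le> int n + int m"
  shows "int_clique (clique_comp star e n m i p q) x y
       = int_clique_comp star e (int m) (int i) (int_clique p) (int_clique q) x y"
proof -
  obtain u v where uv: "x = int u" "y = int v"
    using assms(5,6)
    by (metis dual_order.strict_trans1 less_imp_le nonneg_int_cases zero_le_one order_trans)
  have uv': "1 \<le> u" "u < v" "v \<le> n + m" using assms(5-7) unfolding uv by linarith+
  then have arc: "(u, v) \<in> arcs (n + m - 1)" using assms(1) unfolding arcs_def by simp
  have nat: "nat (int a - int b + 1) = a - b + 1" if "b \<le> a" for a b using that by linarith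
  have suc: "nat (int a + 1) = a + 1" for a by linarith
  have one: "nat 1 = 1" by simp
  note defs = int_clique_def int_clique_comp_def clique_comp_def base_def
  have le: "int i + int m \<le> int a \<longleftrightarrow> i + m \<le> a" "int a \<le> int i + int m \<longleftrightarrow> a \<le> i + m"
    "int a = int i + int m \<longleftrightarrow> a = i + m" for a by linarith+
  note simps = defs uv arc restrict_apply' prod.case prod.inject le of_nat_le_iff of_nat_eq_iff
    nat_int one suc de_Morgan_conj
  consider "v \<le> i" | "\<not> v \<le> i" "u \<le> i \<and> i + m \<le> v \<and> (u \<noteq> i \<or> v \<noteq> i + m)"
    | "\<not> v \<le> i" "\<not> (u \<le> i \<and> i + m \<le> v \<and> (u \<noteq> i \<or> v \<noteq> i + m))" "i + m \<le> u"
    | "\<not> v \<le> i" "\<not> (u \<le> i \<and> i + m \<le> v \<and> (u \<noteq> i \<or> v \<noteq> i + m))" "\<not> i + m \<le> u"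
      "i \<le> u \<and> v \<le> i + m \<and> (u \<noteq> i \<or> v \<noteq> i + m)"
    | "\<not> v \<le> i" "\<not> (u \<le> i \<and> i + m \<le> v \<and> (u \<noteq> i \<or> v \<noteq> i + m))" "\<not> i + m \<le> u"
      "\<not> (i \<le> u \<and> v \<le> i + m \<and> (u \<noteq> i \<or> v \<noteq> i + m))"
    by blast
  then show ?thesis
  proof cases
    case 1
    then show ?thesis by (simp only: simps if_True)
  next
    case 2
    then have "m \<le> v" by linarith
    then show ?thesis using 2 by (simp only: simps nat if_True if_False simp_thms)
  next
    case 3
    then have "m \<le> u" "m \<le> v" using uv' by linarith+
    then show ?thesis using 3 by (simp only: simps nat if_True if_False simp_thms)
  next
    case 4
    then have "i \<le> u" "i \<le> v" and no: "(u \<le> i \<and> i + m \<le> v) = False"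
      using uv' by auto
    then show ?thesis using 4 by (simp only: simps no nat if_True if_False simp_thms)
  next
    case 5
    show ?thesis by (simp only: simps 5 if_True if_False simp_thms)
  qed
qed

lemma clique_comp_eqI:
  assumes "\<And>x y. 1 \<le> x \<Longrightarrow> x < y \<Longrightarrow> y \<le> int n + 1 \<Longrightarrow> int_clique p x y = int_clique q x y"
    and "p \<in> extensional (arcs n)" "q \<in> extensional (arcs n)"
  shows "p = q"
proof (rule extensionalityI[OF assms(2,3)], clarify)
  fix x y assume "(x, y) \<in> arcs n"
  then show "p (x, y) = q (x, y)"
    using assms(1)[of "int x" "int y"] by (auto simp: arcs_def int_clique_def)
qed

lemma clique_comp_extensional: "clique_comp star e n m i p q \<in> extensional (arcs (n + m - 1))"
  by (simp add: clique_comp_def)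

lemma clique_comp_assoc:
  assumes "unitary_magma star e" and ge: "n \<ge> 1" "m \<ge> 1" "l \<ge> 1"
    and i: "i \<in> {1..n}" and j: "j \<in> {1..m}"
    and q: "q \<in> cliques e m"
  shows "clique_comp star e (n + m - 1) l (i + j - 1) (clique_comp star e n m i p q) r
       = clique_comp star e n (m + l - 1) i p (clique_comp star e m l j q r)" (is "?L = ?R")
proof (rule clique_comp_eqI)
  interpret unitary_magma star e by fact
  let ?c = "int_clique_comp star e"
  let ?p = "int_clique p" let ?q = "int_clique q" let ?r = "int_clique r"
  fix x y assume xy: "1 \<le> x" "x < y" "y \<le> int (n + m + l - 2) + 1"
  have "int_clique ?L x y
      = ?c (int l) (int (i + j - 1)) (int_clique (clique_comp star e n m i p q)) ?r x y"
    using ge i j xy by (intro int_clique_clique_comp) auto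
  also have "\<dots> = ?c (int l) (int (i + j - 1)) (?c (int m) (int i) ?p ?q) ?r x y"
    using ge i j xy
    by (intro int_clique_comp_cong[of "int (n + m - 1)"] int_clique_clique_comp) auto
  also have "\<dots> = ?c (int (m + l - 1)) (int i) ?p (?c (int l) (int j) ?q ?r) x y"
  proof (cases "m = 1")
    case True
    then have "int_clique q 1 2 = e" "j = 1"
      using q j by (auto simp: cliques_def int_clique_def)
    then show ?thesis
      using int_clique_comp_assoc_1[of x y ?q e star "int l" "int i" ?p ?r] xy ge i True
      by (simp add: left_unit right_unit)
  next
    case False
    then show ?thesis
      using int_clique_comp_assoc[of x y "int j" "int m" "int l" star e "int i" ?p ?q ?r] xy ge i j
      by (simp add: of_nat_diff)
  qed
  also have "\<dots> = ?c (int (m + l - 1)) (int i) ?p (int_clique (clique_comp star e m l j q r)) x y"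
    using ge i j xy
    by (intro int_clique_comp_cong[of "int n"] int_clique_clique_comp[symmetric]) auto
  also have "\<dots> = int_clique ?R x y"
    using ge i j xy by (intro int_clique_clique_comp[symmetric]) auto
  finally show "int_clique ?L x y = int_clique ?R x y" .
next
  have "n + m - 1 + l - 1 = n + m + l - 2" "n + (m + l - 1) - 1 = n + m + l - 2"
    using ge by auto
  then show "?L \<in> extensional (arcs (n + m + l - 2))" "?R \<in> extensional (arcs (n + m + l - 2))"
    using clique_comp_extensional by metis+
qed

lemma clique_comp_commute:
  assumes ge: "n \<ge> 1" "m \<ge> 1" "l \<ge> 1"
    and i: "i \<in> {1..n}" and j: "j \<in> {1..n}" and less: "i < j"
  shows "clique_comp star e (n + m - 1) l (j + m - 1) (clique_comp star e n m i p q) r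
       = clique_comp star e (n + l - 1) m i (clique_comp star e n l j p r) q" (is "?L = ?R")
proof (rule clique_comp_eqI)
  let ?c = "int_clique_comp star e"
  let ?p = "int_clique p" let ?q = "int_clique q" let ?r = "int_clique r"
  fix x y assume xy: "1 \<le> x" "x < y" "y \<le> int (n + m + l - 2) + 1"
  have "int_clique ?L x y
      = ?c (int l) (int (j + m - 1)) (int_clique (clique_comp star e n m i p q)) ?r x y"
    using ge i j xy by (intro int_clique_clique_comp) auto
  also have "\<dots> = ?c (int l) (int (j + m - 1)) (?c (int m) (int i) ?p ?q) ?r x y"
    using ge i j xy
    by (intro int_clique_comp_cong[of "int (n + m - 1)"] int_clique_clique_comp) auto
  also have "\<dots> = ?c (int m) (int i) (?c (int l) (int j) ?p ?r) ?q x y"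
    using int_clique_comp_commute[of x y "int i" "int j" "int m" "int l" star e ?p ?q ?r]
      xy ge less by (simp add: of_nat_diff)
  also have "\<dots> = ?c (int m) (int i) (int_clique (clique_comp star e n l j p r)) ?q x y"
    using ge i j xy
    by (intro int_clique_comp_cong[of "int (n + l - 1)"] int_clique_clique_comp[symmetric]) auto
  also have "\<dots> = int_clique ?R x y"
    using ge i j less xy by (intro int_clique_clique_comp[symmetric]) auto
  finally show "int_clique ?L x y = int_clique ?R x y" .
next
  have "n + m - 1 + l - 1 = n + m + l - 2" "n + l - 1 + m - 1 = n + m + l - 2"
    using ge by auto
  then show "?L \<in> extensional (arcs (n + m + l - 2))" "?R \<in> extensional (arcs (n + m + l - 2))"
    using clique_comp_extensional by metis+
qed


subsection \<open>The clique operad\<close>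

definition pm_scale :: "'k \<Rightarrow> ('a \<Rightarrow>\<^sub>0 'k) \<Rightarrow> ('a \<Rightarrow>\<^sub>0 'k::field)" where
  "pm_scale c f = Poly_Mapping.map ((*) c) f"

lemma lookup_pm_scale: "Poly_Mapping.lookup (pm_scale c f) a = c * Poly_Mapping.lookup f a"
  by (simp add: pm_scale_def Poly_Mapping.map.rep_eq when_def)

interpretation pm: vector_space "pm_scale :: 'k::field \<Rightarrow> ('a \<Rightarrow>\<^sub>0 'k) \<Rightarrow> ('a \<Rightarrow>\<^sub>0 'k)"
  by unfold_locales
    (auto intro!: poly_mapping_eqI simp: lookup_pm_scale lookup_add algebra_simps)

definition clique_pcomp ::
  "('m \<Rightarrow> 'm \<Rightarrow> 'm) \<Rightarrow> 'm \<Rightarrow> nat \<Rightarrow> nat \<Rightarrow> nat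
    \<Rightarrow> ('m clique \<Rightarrow>\<^sub>0 'k::field) \<Rightarrow> ('m clique \<Rightarrow>\<^sub>0 'k) \<Rightarrow> ('m clique \<Rightarrow>\<^sub>0 'k)" where
  "clique_pcomp star e n m i f g =
    (\<Sum>p\<in>Poly_Mapping.keys f. \<Sum>q\<in>Poly_Mapping.keys g.
      Poly_Mapping.single (clique_comp star e n m i p q)
        (Poly_Mapping.lookup f p * Poly_Mapping.lookup g q))"

definition clique_operad ::
  "('m \<Rightarrow> 'm \<Rightarrow> 'm) \<Rightarrow> 'm \<Rightarrow> ('k::field, 'm clique \<Rightarrow>\<^sub>0 'k) ns_operad_data" where
  "clique_operad star e =
    \<lparr>scale = pm_scale,
     component = (\<lambda>n. {f. Poly_Mapping.keys f \<subseteq> cliques e n}),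
     pcomp = clique_pcomp star e,
     op_unit = Poly_Mapping.single (unit_clique e) 1\<rparr>"

definition Lab_cliques :: "'m \<Rightarrow> 'm set \<Rightarrow> 'm set \<Rightarrow> 'm set \<Rightarrow> nat \<Rightarrow> 'm clique set" where
  "Lab_cliques e B E D n =
    {p \<in> cliques e n. p (base n) \<in> B \<and> (\<forall>a\<in>edges n. p a \<in> E) \<and> (\<forall>a\<in>diagonals n. p a \<in> D)}"

definition Lab ::
  "'m \<Rightarrow> 'm set \<Rightarrow> 'm set \<Rightarrow> 'm set \<Rightarrow> nat \<Rightarrow> ('m clique \<Rightarrow>\<^sub>0 'k::field) set" where
  "Lab e B E D n = module.span pm_scale ((\<lambda>p. Poly_Mapping.single p 1) ` Lab_cliques e B E D n)"

lemma clique_pcomp_superset: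
  assumes "finite A" "Poly_Mapping.keys f \<subseteq> A" "finite B" "Poly_Mapping.keys g \<subseteq> B"
  shows "clique_pcomp star e n m i f g = (\<Sum>p\<in>A. \<Sum>q\<in>B.
      Poly_Mapping.single (clique_comp star e n m i p q)
        (Poly_Mapping.lookup f p * Poly_Mapping.lookup g q))"
proof -
  have "clique_pcomp star e n m i f g = (\<Sum>p\<in>Poly_Mapping.keys f. \<Sum>q\<in>B.
      Poly_Mapping.single (clique_comp star e n m i p q)
        (Poly_Mapping.lookup f p * Poly_Mapping.lookup g q))"
    unfolding clique_pcomp_def
    by (intro sum.cong refl sum.mono_neutral_left) (use assms in \<open>auto simp: in_keys_iff\<close>)
  also have "\<dots> = (\<Sum>p\<in>A. \<Sum>q\<in>B.
      Poly_Mapping.single (clique_comp star e n m i p q)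
        (Poly_Mapping.lookup f p * Poly_Mapping.lookup g q))"
    by (intro sum.mono_neutral_left) (use assms in \<open>auto simp: in_keys_iff\<close>)
  finally show ?thesis .
qed

lemma clique_pcomp_add_left:
  "clique_pcomp star e n m i (f + f') g
    = clique_pcomp star e n m i f g + clique_pcomp star e n m i f' g"
proof -
  let ?A = "Poly_Mapping.keys f \<union> Poly_Mapping.keys f'"
  have *: "finite ?A" "Poly_Mapping.keys f \<subseteq> ?A" "Poly_Mapping.keys f' \<subseteq> ?A"
    "Poly_Mapping.keys (f + f') \<subseteq> ?A"
    by (auto dest: subsetD[OF Poly_Mapping.keys_add])
  show ?thesis
    by (subst (1 2 3) clique_pcomp_superset[of ?A _ "Poly_Mapping.keys g"])
      (use * in \<open>auto simp: lookup_add distrib_right single_add sum.distrib\<close>)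
qed

lemma clique_pcomp_add_right:
  "clique_pcomp star e n m i f (g + g')
    = clique_pcomp star e n m i f g + clique_pcomp star e n m i f g'"
proof -
  let ?A = "Poly_Mapping.keys g \<union> Poly_Mapping.keys g'"
  have *: "finite ?A" "Poly_Mapping.keys g \<subseteq> ?A" "Poly_Mapping.keys g' \<subseteq> ?A"
    "Poly_Mapping.keys (g + g') \<subseteq> ?A"
    by (auto dest: subsetD[OF Poly_Mapping.keys_add])
  show ?thesis
    by (subst (1 2 3) clique_pcomp_superset[of "Poly_Mapping.keys f" _ ?A])
      (use * in \<open>auto simp: lookup_add distrib_left single_add sum.distrib\<close>)
qed

lemma pm_scale_single: "pm_scale c (Poly_Mapping.single a d) = Poly_Mapping.single a (c * d)"
  by (rule poly_mapping_eqI) (simp add: lookup_pm_scale lookup_single when_def)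

lemma keys_pm_scale: "Poly_Mapping.keys (pm_scale c f) \<subseteq> Poly_Mapping.keys f"
  by (auto simp: in_keys_iff lookup_pm_scale)

lemma clique_pcomp_scale_left:
  "clique_pcomp star e n m i (pm_scale c f) g = pm_scale c (clique_pcomp star e n m i f g)"
  by (subst (1 2) clique_pcomp_superset[of "Poly_Mapping.keys f" _ "Poly_Mapping.keys g"])
    (auto dest: subsetD[OF keys_pm_scale]
      simp: pm.scale_sum_right pm_scale_single lookup_pm_scale mult.assoc)

lemma clique_pcomp_scale_right:
  "clique_pcomp star e n m i f (pm_scale c g) = pm_scale c (clique_pcomp star e n m i f g)"
  by (subst (1 2) clique_pcomp_superset[of "Poly_Mapping.keys f" _ "Poly_Mapping.keys g"])
    (auto dest: subsetD[OF keys_pm_scale]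
      simp: pm.scale_sum_right pm_scale_single lookup_pm_scale mult_ac)

lemma clique_pcomp_single_left:
  "clique_pcomp star e n m i (Poly_Mapping.single p c) g
    = (\<Sum>q\<in>Poly_Mapping.keys g.
        Poly_Mapping.single (clique_comp star e n m i p q) (c * Poly_Mapping.lookup g q))"
  by (subst clique_pcomp_superset[of "{p}" _ "Poly_Mapping.keys g"]) auto

lemma clique_pcomp_single_right:
  "clique_pcomp star e n m i f (Poly_Mapping.single q c)
    = (\<Sum>p\<in>Poly_Mapping.keys f.
        Poly_Mapping.single (clique_comp star e n m i p q) (Poly_Mapping.lookup f p * c))"
  by (subst clique_pcomp_superset[of "Poly_Mapping.keys f" _ "{q}"]) auto

lemma clique_pcomp_sum_left:
  "clique_pcomp star e n m i (\<Sum>a\<in>A. F a) g = (\<Sum>a\<in>A. clique_pcomp star e n m i (F a) g)"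
  by (induction A rule: infinite_finite_induct)
    (simp_all add: clique_pcomp_add_left, simp_all add: clique_pcomp_def)

lemma clique_pcomp_sum_right:
  "clique_pcomp star e n m i f (\<Sum>a\<in>A. G a) = (\<Sum>a\<in>A. clique_pcomp star e n m i f (G a))"
  by (induction A rule: infinite_finite_induct)
    (simp_all add: clique_pcomp_add_right, simp_all add: clique_pcomp_def)

lemma clique_pcomp_pcomp_left:
  "clique_pcomp star e n m i (clique_pcomp star e n' m' i' f g) h
    = (\<Sum>p\<in>Poly_Mapping.keys f. \<Sum>q\<in>Poly_Mapping.keys g.
        \<Sum>r\<in>Poly_Mapping.keys h. Poly_Mapping.single
        (clique_comp star e n m i (clique_comp star e n' m' i' p q) r)
        (Poly_Mapping.lookup f p * Poly_Mapping.lookup g q * Poly_Mapping.lookup h r))"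
  by (simp add: clique_pcomp_def[of star e n' m' i' f g] clique_pcomp_sum_left
      clique_pcomp_single_left)

lemma clique_pcomp_pcomp_right:
  "clique_pcomp star e n m i f (clique_pcomp star e n' m' i' g h)
    = (\<Sum>p\<in>Poly_Mapping.keys f. \<Sum>q\<in>Poly_Mapping.keys g.
        \<Sum>r\<in>Poly_Mapping.keys h. Poly_Mapping.single
        (clique_comp star e n m i p (clique_comp star e n' m' i' q r))
        (Poly_Mapping.lookup f p * Poly_Mapping.lookup g q * Poly_Mapping.lookup h r))"
proof -
  have "clique_pcomp star e n m i f (clique_pcomp star e n' m' i' g h)
    = (\<Sum>q\<in>Poly_Mapping.keys g. \<Sum>r\<in>Poly_Mapping.keys h.
        \<Sum>p\<in>Poly_Mapping.keys f. Poly_Mapping.single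
        (clique_comp star e n m i p (clique_comp star e n' m' i' q r))
        (Poly_Mapping.lookup f p * Poly_Mapping.lookup g q * Poly_Mapping.lookup h r))"
    by (simp add: clique_pcomp_def[of star e n' m' i' g h] clique_pcomp_sum_right
        clique_pcomp_single_right mult.assoc)
  also have "\<dots> = (\<Sum>q\<in>Poly_Mapping.keys g. \<Sum>p\<in>Poly_Mapping.keys f.
      \<Sum>r\<in>Poly_Mapping.keys h. Poly_Mapping.single
        (clique_comp star e n m i p (clique_comp star e n' m' i' q r))
        (Poly_Mapping.lookup f p * Poly_Mapping.lookup g q * Poly_Mapping.lookup h r))"
    by (intro sum.cong refl sum.swap)
  also have "\<dots> = (\<Sum>p\<in>Poly_Mapping.keys f. \<Sum>q\<in>Poly_Mapping.keys g.
      \<Sum>r\<in>Poly_Mapping.keys h. Poly_Mapping.single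
        (clique_comp star e n m i p (clique_comp star e n' m' i' q r))
        (Poly_Mapping.lookup f p * Poly_Mapping.lookup g q * Poly_Mapping.lookup h r))"
    by (rule sum.swap)
  finally show ?thesis .
qed

lemma sum_single_lookup:
  "(\<Sum>p\<in>Poly_Mapping.keys f. Poly_Mapping.single p (Poly_Mapping.lookup f p)) = f"
  by (rule poly_mapping_eqI)
    (auto simp: lookup_sum lookup_single when_def in_keys_iff sum.delta)

lemma ns_operad_clique_operad:
  assumes "unitary_magma star e"
  shows "ns_operad
    (clique_operad star e :: ('k::field, 'm clique \<Rightarrow>\<^sub>0 'k) ns_operad_data)"
proof -
  let ?P = "clique_operad star e :: ('k, 'm clique \<Rightarrow>\<^sub>0 'k) ns_operad_data"
  have vs: "vector_space (scale ?P)"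
    unfolding clique_operad_def ns_operad_data.simps by (rule pm.vector_space_axioms)
  have closed: "Poly_Mapping.keys (clique_pcomp star e n m i f g) \<subseteq> cliques e (n + m - 1)"
    if "n \<ge> 1" "m \<ge> 1" "i \<in> {1..n}" "Poly_Mapping.keys f \<subseteq> cliques e n"
      "Poly_Mapping.keys g \<subseteq> cliques e m"
    for n m i and f g :: "'m clique \<Rightarrow>\<^sub>0 'k"
  proof
    fix c assume "c \<in> Poly_Mapping.keys (clique_pcomp star e n m i f g)"
    then obtain p q where "p \<in> Poly_Mapping.keys f" "q \<in> Poly_Mapping.keys g"
      "c \<in> Poly_Mapping.keys (Poly_Mapping.single (clique_comp star e n m i p q)
        (Poly_Mapping.lookup f p * Poly_Mapping.lookup g q))"
      unfolding clique_pcomp_def by (auto dest!: subsetD[OF keys_sum])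
    then have "c = clique_comp star e n m i p q" "p \<in> cliques e n" "q \<in> cliques e m"
      using that by (auto split: if_splits)
    then show "c \<in> cliques e (n + m - 1)"
      using clique_comp_in_cliques[OF assms] that by auto
  qed
  show ?thesis
    unfolding ns_operad_def ns_operad_axioms_def
  proof (intro conjI allI impI vs, goal_cases)
    case (1 n)
    show ?case
      unfolding clique_operad_def ns_operad_data.simps
      by (intro pm.subspaceI)
        (auto dest!: subsetD[OF Poly_Mapping.keys_add] subsetD[OF keys_pm_scale])
  next
    case 2
    show ?case by (auto simp: clique_operad_def unit_clique_def cliques_def arcs_def)
  next
    case 3
    then show ?case using closed by (simp add: clique_operad_def)
  next
    case 4
    then show ?case by (simp add: clique_operad_def clique_pcomp_add_left)
  next
    case 5
    then show ?case by (simp add: clique_operad_def clique_pcomp_add_right)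
  next
    case 6
    then show ?case by (simp add: clique_operad_def clique_pcomp_scale_left)
  next
    case 7
    then show ?case by (simp add: clique_operad_def clique_pcomp_scale_right)
  next
    case (8 m g)
    have "clique_pcomp star e 1 m 1 (Poly_Mapping.single (unit_clique e) 1) g
        = (\<Sum>q\<in>Poly_Mapping.keys g. Poly_Mapping.single q (Poly_Mapping.lookup g q))"
      unfolding clique_pcomp_single_left
      by (intro sum.cong) (use 8 clique_comp_unit_left[OF assms] in \<open>auto simp: clique_operad_def\<close>)
    then show ?case by (simp add: clique_operad_def sum_single_lookup)
  next
    case (9 n i f)
    have "clique_pcomp star e n 1 i f (Poly_Mapping.single (unit_clique e) 1)
        = (\<Sum>p\<in>Poly_Mapping.keys f. Poly_Mapping.single p (Poly_Mapping.lookup f p))"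
      unfolding clique_pcomp_single_right
      by (intro sum.cong) (use 9 clique_comp_unit_right[OF assms] in \<open>auto simp: clique_operad_def\<close>)
    then show ?case by (simp add: clique_operad_def sum_single_lookup)
  next
    case (10 n m l i j f g h)
    then have "q \<in> cliques e m" if "q \<in> Poly_Mapping.keys g" for q
      using that by (auto simp: clique_operad_def)
    then show ?case
      using 10 clique_comp_assoc[OF assms, of n m l i j]
      by (simp add: clique_operad_def clique_pcomp_pcomp_left clique_pcomp_pcomp_right)
  next
    case (11 n m l i j f g h)
    let ?s = "\<lambda>p q r. Poly_Mapping.single
      (clique_comp star e (n + m - 1) l (j + m - 1) (clique_comp star e n m i p q) r)
      (Poly_Mapping.lookup f p * Poly_Mapping.lookup g q * Poly_Mapping.lookup h r)"
    have "?s p q r = Poly_Mapping.single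
        (clique_comp star e (n + l - 1) m i (clique_comp star e n l j p r) q)
        (Poly_Mapping.lookup f p * Poly_Mapping.lookup h r * Poly_Mapping.lookup g q)" for p q r
      using clique_comp_commute[of n m l i j star e p q r] 11(1-6) by (simp only: mult_ac)
    note s = this
    have "(\<Sum>p\<in>Poly_Mapping.keys f. \<Sum>q\<in>Poly_Mapping.keys g.
        \<Sum>r\<in>Poly_Mapping.keys h. ?s p q r)
      = (\<Sum>p\<in>Poly_Mapping.keys f. \<Sum>r\<in>Poly_Mapping.keys h.
        \<Sum>q\<in>Poly_Mapping.keys g. ?s p q r)"
      by (intro sum.cong refl sum.swap)
    then show ?case
      by (simp only: clique_operad_def ns_operad_data.simps clique_pcomp_pcomp_left s)
  qed
qed

end

theory Submission
  imports Defs
begin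

text \<open>
  The operad unit is admissible since its only arc, the base, is labeled by the unit of the magma,
  which lies in \<open>B\<close>. For closure under the partial compositions, which are bilinear, it suffices
  to compose two cliques \<open>p\<close> and \<open>q\<close> with admissible labels, of arities \<open>n\<close> and \<open>m\<close>. If one of
  them has arity 1, it is the operad unit and the composite is the other one. Otherwise the base of
  \<open>q\<close> is glued to the \<open>i\<close>-th edge of \<open>p\<close>, and the result is a diagonal labeled by an element of
  \<open>E \<star> B \<subseteq> D\<close>. The base of \<open>p\<close> becomes the base of the composite, and all other arcs of \<open>p\<close> and
  \<open>q\<close> keep their label and remain edges or diagonals. The remaining arcs cross the glued one; they
  are diagonals labeled by the unit, which lies in \<open>D\<close>. This is the content of the lemma
  \<open>clique_comp_in_Lab_cliques\<close>. The lemma \<open>Lab_eq_keys\<close>, which describes the span of a set of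
  basis cliques as the set of vectors supported on it, transfers the result to vectors.
\<close>

text \<open>Stating the label conditions arc by arc turns the closure under composition into a case
  distinction on one arc.\<close>

lemma Lab_cliques_iff:
  assumes "n \<ge> 1"
  shows "p \<in> Lab_cliques e B E D n \<longleftrightarrow> p \<in> cliques e n \<and>
    (\<forall>x y. 1 \<le> x \<and> x < y \<and> y \<le> n + 1 \<longrightarrow>
      p (x, y) \<in> (if x = 1 \<and> y = n + 1 then B else if y = x + 1 then E else D))"
    (is "_ \<longleftrightarrow> _ \<and> ?labels")
proof -
  have "(p (base n) \<in> B \<and> (\<forall>a\<in>edges n. p a \<in> E) \<and> (\<forall>a\<in>diagonals n. p a \<in> D)) \<longleftrightarrow> ?labels"
    (is "?L \<longleftrightarrow> _")
  proof
    assume ?L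
    then have "p (1, n + 1) \<in> B"
      "\<And>x y. (x, y) \<in> edges n \<Longrightarrow> p (x, y) \<in> E"
      "\<And>x y. (x, y) \<in> diagonals n \<Longrightarrow> p (x, y) \<in> D"
      by (auto simp: base_def)
    then show ?labels by (simp add: edges_def diagonals_def arcs_def base_def)
  next
    assume labels: ?labels
    have "p (base n) \<in> B" using labels[rule_format, of 1 "n + 1"] assms by (simp add: base_def)
    moreover have "p (x, y) \<in> E" if "(x, y) \<in> edges n" for x y
      using labels[rule_format, of x y] that
      by (auto simp: edges_def arcs_def base_def split: if_splits)
    moreover have "p (x, y) \<in> D" if "(x, y) \<in> diagonals n" for x y
      using labels[rule_format, of x y] that
      by (auto simp: diagonals_def edges_def arcs_def base_def split: if_splits)
    ultimately show ?L by auto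
  qed
  then show ?thesis by (auto simp: Lab_cliques_def)
qed

lemma cliques_1:
  assumes "p \<in> cliques e 1"
  shows "p = unit_clique e"
proof (rule extensionalityI[of _ "arcs 1"])
  fix a assume "a \<in> arcs 1"
  then have "a = (1, 2)" by (auto simp: arcs_def)
  then show "p a = unit_clique e a"
    using assms by (auto simp: cliques_def unit_clique_def arcs_def)
qed (use assms in \<open>auto simp: cliques_def unit_clique_def PiE_def\<close>)

lemma clique_comp_in_Lab_cliques:
  assumes magma: "unitary_magma star e" and "e \<in> D" and EB: "set_star star E B \<subseteq> D"
    and n: "n \<ge> 1" and m: "m \<ge> 1" and i: "i \<in> {1..n}"
    and p: "p \<in> Lab_cliques e B E D n" and q: "q \<in> Lab_cliques e B E D m"
  shows "clique_comp star e n m i p q \<in> Lab_cliques e B E D (n + m - 1)"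
proof -
  have pc: "p \<in> cliques e n" and qc: "q \<in> cliques e m"
    using p q by (auto simp: Lab_cliques_def)
  consider "n = 1" | "m = 1" | "n \<ge> 2" "m \<ge> 2" using n m by linarith
  then show ?thesis
  proof cases
    case 1
    then have "p = unit_clique e" "i = 1" using cliques_1 pc i by auto
    then show ?thesis using clique_comp_unit_left[OF magma m qc] q 1 by simp
  next
    case 2
    then have "q = unit_clique e" using cliques_1 qc by auto
    then show ?thesis using clique_comp_unit_right[OF magma n i pc] p 2 by simp
  next
    case 3
    let ?N = "n + m - 1"
    let ?c = "clique_comp star e n m i p q"
    have P: "p (x, y) \<in> (if x = 1 \<and> y = n + 1 then B else if y = x + 1 then E else D)"
      if "1 \<le> x" "x < y" "y \<le> n + 1" for x y
      using p that unfolding Lab_cliques_iff[OF n] by simp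
    have Q: "q (x, y) \<in> (if x = 1 \<and> y = m + 1 then B else if y = x + 1 then E else D)"
      if "1 \<le> x" "x < y" "y \<le> m + 1" for x y
      using q that unfolding Lab_cliques_iff[OF m] by simp
    have "?c (x, y) \<in> (if x = 1 \<and> y = ?N + 1 then B else if y = x + 1 then E else D)"
      if xy: "1 \<le> x" "x < y" "y \<le> ?N + 1" for x y
    proof -
      note simps = clique_comp_def arcs_def base_def
      have "y \<le> i \<or> i < y" "i + m \<le> x \<or> x < i + m" "x \<le> i \<or> i < x" "i \<le> x \<or> x < i"
        "i + m \<le> y \<or> y < i + m" "y \<le> i + m \<or> i + m < y" "i < x \<longrightarrow> i \<le> x"
        "y < i + m \<longrightarrow> y \<le> i + m"
        by linarith+
      \<comment> \<open>Arcs inherited from \<open>p\<close> lie left of, right of, or around the glued arc \<open>(i, i + m)\<close>,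
        those inherited from \<open>q\<close> lie inside it, and the others cross it. A crossing arc joins
        vertices at distance at least 2 and is not the base, so it is a diagonal.\<close>
      then consider (left) "y \<le> i" | (right) "i + m \<le> x" | (glued) "x = i" "y = i + m"
        | (around) "x \<le> i" "i + m \<le> y" "\<not> (x = i \<and> y = i + m)"
        | (inside) "i \<le> x" "y \<le> i + m" "\<not> (x = i \<and> y = i + m)"
        | (crossing) "x < i" "i < y" "y < i + m" | (crossing') "i < x" "x < i + m" "i + m < y"
        by blast
      then show ?thesis
      proof cases
        case left
        then show ?thesis using P[of x y] xy i 3 by (auto simp: simps split: if_splits)
      next
        case around
        \<comment> \<open>Such an arc comes from the base or from a diagonal of \<open>p\<close>.\<close>
        then have "?c (x, y) = p (x, y - m + 1)" using xy i 3 by (auto simp: simps)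
        moreover have "y - m + 1 = n + 1 \<longleftrightarrow> y = ?N + 1" "y - m + 1 \<noteq> x + 1" "y \<noteq> x + 1"
          "x < y - m + 1" "y - m + 1 \<le> n + 1"
          using around xy i 3 by auto
        ultimately show ?thesis using P[of x "y - m + 1"] xy(1)
          by (auto split: if_splits)
      next
        case right
        then have "?c (x, y) = p (x - m + 1, y - m + 1)" using xy i 3 by (auto simp: simps)
        moreover have "x - m + 1 \<noteq> 1" "x \<noteq> 1" "y - m + 1 = x - m + 1 + 1 \<longleftrightarrow> y = x + 1"
          "x - m + 1 < y - m + 1" "y - m + 1 \<le> n + 1"
          using right xy i 3 by auto
        ultimately show ?thesis using P[of "x - m + 1" "y - m + 1"] by (auto split: if_splits)
      next
        case inside
        then have "?c (x, y) = q (x - i + 1, y - i + 1)" using xy i 3 by (auto simp: simps)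
        moreover have "\<not> (x - i + 1 = 1 \<and> y - i + 1 = m + 1)" "\<not> (x = 1 \<and> y = ?N + 1)"
          "y - i + 1 = x - i + 1 + 1 \<longleftrightarrow> y = x + 1" "x - i + 1 < y - i + 1" "y - i + 1 \<le> m + 1"
          using inside xy i 3 by auto
        ultimately show ?thesis using Q[of "x - i + 1" "y - i + 1"] by (auto split: if_splits)
      next
        case glued
        have "p (i, i + 1) \<in> E" using P[of i "i + 1"] i 3 by (auto split: if_splits)
        moreover have "q (1, m + 1) \<in> B" using Q[of 1 "m + 1"] 3 by auto
        ultimately have "star (p (i, i + 1)) (q (1, m + 1)) \<in> D"
          using EB by (auto simp: set_star_def)
        then show ?thesis using glued i 3 by (auto simp: simps)
      next
        case crossing
        then show ?thesis using \<open>e \<in> D\<close> xy i 3 by (auto simp: simps)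
      next
        case crossing'
        then show ?thesis using \<open>e \<in> D\<close> xy i 3 by (auto simp: simps)
      qed
    qed
    moreover have "?c \<in> cliques e ?N" by (rule clique_comp_in_cliques[OF magma n m i pc qc])
    ultimately show ?thesis using n m by (simp add: Lab_cliques_iff)
  qed
qed

lemma subspace_keys_subset: "pm.subspace {f. Poly_Mapping.keys f \<subseteq> A}"
  by (intro pm.subspaceI)
    (auto dest!: subsetD[OF Poly_Mapping.keys_add] subsetD[OF keys_pm_scale])

lemma span_single_eq_keys:
  "pm.span ((\<lambda>p. Poly_Mapping.single p (1::'k::field)) ` A) = {f. Poly_Mapping.keys f \<subseteq> A}"
proof
  show "pm.span ((\<lambda>p. Poly_Mapping.single p (1::'k)) ` A) \<subseteq> {f. Poly_Mapping.keys f \<subseteq> A}"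
    by (rule pm.span_minimal[OF _ subspace_keys_subset]) auto
next
  show "{f. Poly_Mapping.keys f \<subseteq> A} \<subseteq> pm.span ((\<lambda>p. Poly_Mapping.single p (1::'k)) ` A)"
  proof clarify
    fix f :: "'a \<Rightarrow>\<^sub>0 'k" assume f: "Poly_Mapping.keys f \<subseteq> A"
    have "(\<Sum>p\<in>Poly_Mapping.keys f.
        pm_scale (Poly_Mapping.lookup f p) (Poly_Mapping.single p 1))
      \<in> pm.span ((\<lambda>p. Poly_Mapping.single p 1) ` A)"
      using f by (intro pm.span_sum pm.span_scale pm.span_base) auto
    then show "f \<in> pm.span ((\<lambda>p. Poly_Mapping.single p 1) ` A)"
      by (simp add: pm_scale_single sum_single_lookup)
  qed
qed

lemma Lab_eq_keys:
  "Lab e B E D n = {f. Poly_Mapping.keys f \<subseteq> Lab_cliques e B E D n}"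
  unfolding Lab_def by (rule span_single_eq_keys)

lemma keys_clique_pcomp:
  "Poly_Mapping.keys (clique_pcomp star e n m i f g) \<subseteq>
    {clique_comp star e n m i p q | p q. p \<in> Poly_Mapping.keys f \<and> q \<in> Poly_Mapping.keys g}"
  unfolding clique_pcomp_def by (fastforce dest!: subsetD[OF keys_sum] split: if_splits)

theorem proposition3p1p1:
  fixes star :: "'m \<Rightarrow> 'm \<Rightarrow> 'm" and e :: 'm and B E D :: "'m set"
  assumes "unitary_magma star e"
    and "e \<in> B"
    and "e \<in> D"
    and "set_star star E B \<subseteq> D"
  shows "ns_suboperad
    (clique_operad star e :: ('k::field_char_0, 'm clique \<Rightarrow>\<^sub>0 'k) ns_operad_data)
    (Lab e B E D)"
proof -
  have "unit_clique e \<in> Lab_cliques e B E D 1"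
    using \<open>e \<in> B\<close>
    by (auto simp: Lab_cliques_iff cliques_def unit_clique_def arcs_def)
  moreover have "Poly_Mapping.keys (clique_pcomp star e n m i f g)
      \<subseteq> Lab_cliques e B E D (n + m - 1)"
    if "n \<ge> 1" "m \<ge> 1" "i \<in> {1..n}" "Poly_Mapping.keys f \<subseteq> Lab_cliques e B E D n"
      "Poly_Mapping.keys g \<subseteq> Lab_cliques e B E D m"
    for n m i and f g :: "'m clique \<Rightarrow>\<^sub>0 'k"
    using keys_clique_pcomp[of star e n m i f g] that
      clique_comp_in_Lab_cliques[OF assms(1,3,4) that(1-3)] by blast
  moreover have "Poly_Mapping.keys f \<subseteq> cliques e n"
    if "Poly_Mapping.keys f \<subseteq> Lab_cliques e B E D n" for n and f :: "'m clique \<Rightarrow>\<^sub>0 'k"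
    using that by (auto simp: Lab_cliques_def)
  ultimately show ?thesis
    unfolding ns_suboperad_def ns_suboperad_axioms_def
    by (intro conjI ns_operad_clique_operad[OF assms(1)])
      (simp_all add: clique_operad_def Lab_eq_keys Collect_mono_iff subspace_keys_subset)
qed

end
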